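(* Let $R$ be an integral domain such that $R/(m)$ is finite for every $m\in R\setminus\{0\}$, and let $K$ be its field of fractions. Let $\Omega$ be the spectrum of the relations $\mathcal{R}$ on $K\rtimes K^\times$ and let $\hat R_K$ be the inverse limit ring, both as defined in the context. Then the map $$\rho:\hat R_K\longrightarrow\Omega,\qquad \rho\big((u_w+(w))_w\big)=\{(u_w+rw,w) : w\in K^\times,\ r\in R\},$$ is a homeomorphism.
   Context: An integral domain is a unital commutative ring without zero divisors. $R^\times=R\setminus\{0\}$, $K^\times=K\setminus\{0\}$. The group $G=K\rtimes K^\times$ consists of pairs $(u,w)$, $u\in K$, $w\in K^\times$, with $(u,w)(u',w')=(u+u'w,ww')$, $(u,w)^{-1}=(-u/w,1/w)$ and identity $e=(0,1)$. Spectrum. Give the power set $\mathcal{P}(G)$ the topology of $\{0,1\}^G$ (product topology) and let $X_G=\{\xi\subseteq G : e\in\xi\}$ with the induced topology. For $g\in G$ let $1_g\in C(X_G)$ be $1_g(\xi)=1$ if $g\in\xi$ and $0$ otherwise. Let $\mathcal{R}\subseteq C(X_G)$ be the set consisting of the functions $1_{(n,1)}-1$ ($n\in R$), $1_{(0,1/m)}-1$ ($m\in R^\times$), and $\sum_{n+(m)\in R/(m)}1_{(n,m)}-1$ ($m\in R^\times$; one representative $n$ is chosen for each class, and the set $\Omega$ below does not depend on the choice). Define $$\Omega=\{\xi\in X_G : f(g^{-1}\xi)=0\ \text{ for all } f\in\mathcal{R} \text{ and all } g\in\xi\},$$ with the topology induced from $X_G$. The ring $\hat R_K$. For $w,w'\in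 K^\times$ write $w\le w'$ if $w'=wr$ for some $r\in R$, and let $(w)=wR\subseteq K$. If $w\le w'$ let $p_{w,w'}:(R+(w'))/(w')\to(R+(w))/(w)$ be the canonical projection. Then $$\hat R_K=\Big\{(u_w+(w))_w\in\prod_{w\in K^\times}(R+(w))/(w) : p_{w,w'}(u_{w'}+(w'))=u_w+(w)\text{ whenever } w\le w'\Big\},$$ with the topology induced by the product topology, each $(R+(w))/(w)$ being discrete. (It is naturally isomorphic, as a topological ring, to the profinite completion $\hat R=\varprojlim_{m\in R^\times}R/(m)$.) The definition of $\rho$ is independent of the choice of representatives $u_w$. *)

theory Defs
  imports
    "HOL-Analysis.Analysis"
    "HOL-Algebra.Coset"
    "HOL-Computational_Algebra.Polynomial_Factorial"
begin

text \<open>Throughout, \<open>R\<close> is the integral domain \<open>'a :: idom\<close>, \<open>K\<close> is its field of fractions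
  \<open>'a fract\<close>, and \<open>R\<close> is embedded in \<open>K\<close> by \<^const>\<open>to_fract\<close>.\<close>

section \<open>The group and its power set\<close>

definition affine_group :: "('a::idom fract \<times> 'a fract) monoid" where
  "affine_group =
    \<lparr>carrier = {(u, w). w \<noteq> 0},
     mult = (\<lambda>(u, w) (u', w'). (u + u' * w, w * w')),
     one = (0, 1)\<rparr>"

lemma group_affine_group: "group (affine_group :: ('a::idom fract \<times> 'a fract) monoid)"
proof (rule groupI)
  fix x :: "'a fract \<times> 'a fract"
  assume "x \<in> carrier affine_group"
  then obtain u w where x: "x = (u, w)" "w \<noteq> 0"
    by (auto simp: affine_group_def)
  show "\<exists>y\<in>carrier affine_group. y \<otimes>\<^bsub>affine_group\<^esub> x = \<one>\<^bsub>affine_group\<^esub>"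
    by (rule bexI[of _ "(- u / w, 1 / w)"]) (use x in \<open>auto simp: affine_group_def\<close>)
qed (auto simp: affine_group_def algebra_simps)

lemma inv_affine_group:
  assumes "w \<noteq> 0"
  shows "inv\<^bsub>affine_group\<^esub> (u, w) = (- u / w, 1 / w)"
  by (rule group.inv_equality[OF group_affine_group])
    (use assms in \<open>auto simp: affine_group_def\<close>)

text \<open>A subset of \<open>G\<close> is identified with its indicator function in \<open>{0,1}\<^sup>G\<close>; the restriction to
  the carrier makes that function extensional, as \<^const>\<open>product_topology\<close> requires.\<close>

definition powerset_topology :: "('g, 'b) monoid_scheme \<Rightarrow> 'g set topology" where
  "powerset_topology G =
    pullback_topology (Pow (carrier G)) (\<lambda>\<xi>. restrict (indicator \<xi>) (carrier G))
      (product_topology (\<lambda>_. discrete_topology {0, 1 :: nat}) (carrier G))"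

lemma topspace_powerset_topology: "topspace (powerset_topology G) = Pow (carrier G)"
  by (auto simp: powerset_topology_def topspace_pullback_topology indicator_def)

definition X_topology :: "('g, 'b) monoid_scheme \<Rightarrow> 'g set topology" where
  "X_topology G = subtopology (powerset_topology G) {\<xi>. \<one>\<^bsub>G\<^esub> \<in> \<xi>}"

section \<open>The spectrum of a set of relations\<close>

definition one_at :: "'g \<Rightarrow> 'g set \<Rightarrow> complex" where
  "one_at g \<xi> = (if g \<in> \<xi> then 1 else 0)"

lemma continuous_map_one_at:
  assumes "g \<in> carrier G"
  shows "continuous_map (X_topology G) euclidean (one_at g)"
proof -
  let ?P = "product_topology (\<lambda>_. discrete_topology {0, 1 :: nat}) (carrier G)"
  have "continuous_map ?P (discrete_topology {0, 1}) (\<lambda>x. x g)"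
    using assms by (rule continuous_map_product_projection)
  moreover have "continuous_map (discrete_topology {0, 1 :: nat}) euclidean (of_nat :: nat \<Rightarrow> complex)"
    by simp
  ultimately have "continuous_map ?P euclidean ((of_nat :: nat \<Rightarrow> complex) \<circ> (\<lambda>x. x g))"
    by (rule continuous_map_compose)
  then have "continuous_map (powerset_topology G) euclidean
      (((of_nat :: nat \<Rightarrow> complex) \<circ> (\<lambda>x. x g)) \<circ> (\<lambda>\<xi>. restrict (indicator \<xi>) (carrier G)))"
    unfolding powerset_topology_def by (rule continuous_map_pullback)
  then have "continuous_map (powerset_topology G) euclidean (one_at g)"
    by (rule continuous_map_eq) (use assms in \<open>auto simp: one_at_def indicator_def\<close>)
  then show ?thesis
    unfolding X_topology_def by (rule continuous_map_from_subtopology)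
qed

definition spectrum :: "('g, 'b) monoid_scheme \<Rightarrow> ('g set \<Rightarrow> complex) set \<Rightarrow> 'g set set" where
  "spectrum G \<R> =
    {\<xi> \<in> topspace (X_topology G). \<forall>f\<in>\<R>. \<forall>g\<in>\<xi>. f (inv\<^bsub>G\<^esub> g <#\<^bsub>G\<^esub> \<xi>) = 0}"

definition residue_ring_set :: "'a::idom \<Rightarrow> 'a set set" where
  "residue_ring_set m = range (\<lambda>n. n +o range ((*) m))"

text \<open>\<open>rep m C\<close> is the representative chosen for the class \<open>C \<in> R/(m)\<close>.\<close>

definition is_choice_of_reps :: "('a::idom \<Rightarrow> 'a set \<Rightarrow> 'a) \<Rightarrow> bool" where
  "is_choice_of_reps rep \<longleftrightarrow> (\<forall>m. m \<noteq> 0 \<longrightarrow> (\<forall>C\<in>residue_ring_set m. rep m C \<in> C))"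

definition relations ::
    "('a::idom \<Rightarrow> 'a set \<Rightarrow> 'a) \<Rightarrow> (('a fract \<times> 'a fract) set \<Rightarrow> complex) set" where
  "relations rep =
    {\<lambda>\<xi>. one_at (to_fract n, 1) \<xi> - 1 | n. True} \<union>
    {\<lambda>\<xi>. one_at (0, 1 / to_fract m) \<xi> - 1 | m. m \<noteq> 0} \<union>
    {\<lambda>\<xi>. (\<Sum>C\<in>residue_ring_set m. one_at (to_fract (rep m C), to_fract m) \<xi>) - 1 | m. m \<noteq> 0}"

definition Omega_topology ::
    "('a::idom \<Rightarrow> 'a set \<Rightarrow> 'a) \<Rightarrow> ('a fract \<times> 'a fract) set topology" where
  "Omega_topology rep = subtopology (X_topology affine_group) (spectrum affine_group (relations rep))"

section \<open>The inverse limit\<close>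

definition frac_ideal :: "'a::idom fract \<Rightarrow> 'a fract set" where
  "frac_ideal w = range (\<lambda>r. w * to_fract r)"

definition frac_le :: "'a::idom fract \<Rightarrow> 'a fract \<Rightarrow> bool" where
  "frac_le w w' \<longleftrightarrow> (\<exists>r. w' = w * to_fract r)"

text \<open>\<open>(R + (w))/(w)\<close>, where \<open>+\<close> in \<^term>\<open>range to_fract + frac_ideal w\<close> is the sum of sets.\<close>

definition frac_quotient :: "'a::idom fract \<Rightarrow> 'a fract set set" where
  "frac_quotient w = (\<lambda>u. u +o frac_ideal w) ` (range to_fract + frac_ideal w)"

text \<open>The projection \<open>p\<^bsub>w,w'\<^esub>\<close>; it depends on \<open>w'\<close> only through its domain.\<close>

definition frac_proj :: "'a::idom fract \<Rightarrow> 'a fract set \<Rightarrow> 'a fract set" where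
  "frac_proj w C = (\<Union>u\<in>C. u +o frac_ideal w)"

lemma mem_frac_coset: "v \<in> u +o frac_ideal w \<longleftrightarrow> (\<exists>r. v = u + w * to_fract r)"
  by (auto simp: elt_set_plus_def frac_ideal_def)

lemma frac_coset_self: "u \<in> u +o frac_ideal w"
  unfolding mem_frac_coset by (rule exI[of _ 0]) simp

lemma frac_coset_eq:
  assumes "v \<in> u +o frac_ideal w"
  shows "v +o frac_ideal w = u +o frac_ideal w"
proof -
  obtain r where v: "v = u + w * to_fract r"
    using assms unfolding mem_frac_coset by blast
  have "u + w * to_fract r + w * to_fract s = u + w * to_fract (r + s)" for s
    by (simp add: algebra_simps)
  moreover have "u + w * to_fract s = u + w * to_fract r + w * to_fract (s - r)" for s
    by (simp add: algebra_simps)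
  ultimately show ?thesis
    unfolding set_eq_iff mem_frac_coset v by metis
qed

lemma frac_proj_coset:
  assumes "frac_le w w'"
  shows "frac_proj w (u +o frac_ideal w') = u +o frac_ideal w"
proof -
  obtain r where w': "w' = w * to_fract r"
    using assms unfolding frac_le_def by blast
  have "u + w' * to_fract s = u + w * to_fract (r * s)" for s
    by (simp add: w' mult.assoc)
  then have "v \<in> u +o frac_ideal w" if "v \<in> u +o frac_ideal w'" for v
    using that unfolding mem_frac_coset by metis
  then have "v +o frac_ideal w = u +o frac_ideal w" if "v \<in> u +o frac_ideal w'" for v
    using that frac_coset_eq by blast
  then have "frac_proj w (u +o frac_ideal w') = (\<Union>v\<in>u +o frac_ideal w'. u +o frac_ideal w)"
    unfolding frac_proj_def by (intro SUP_cong refl)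
  then show ?thesis
    using frac_coset_self[of u w'] by blast
qed

definition Rhat_K :: "('a::idom fract \<Rightarrow> 'a fract set) set" where
  "Rhat_K = {x \<in> Pi\<^sub>E {w. w \<noteq> 0} frac_quotient.
    \<forall>w w'. w \<noteq> 0 \<and> w' \<noteq> 0 \<and> frac_le w w' \<longrightarrow> frac_proj w (x w') = x w}"

definition Rhat_K_topology :: "('a::idom fract \<Rightarrow> 'a fract set) topology" where
  "Rhat_K_topology =
    subtopology (product_topology (\<lambda>w. discrete_topology (frac_quotient w)) {w. w \<noteq> 0}) Rhat_K"

lemma topspace_Rhat_K_topology: "topspace Rhat_K_topology = Rhat_K"
  by (auto simp: Rhat_K_topology_def Rhat_K_def)

section \<open>The map\<close>

text \<open>The lemma \<open>rho_eq\<close> shows that the choice of the representatives \<open>u\<^sub>w\<close> does not matter.\<close>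

definition rho :: "('a::idom fract \<Rightarrow> 'a fract set) \<Rightarrow> ('a fract \<times> 'a fract) set" where
  "rho x =
    (let u = (\<lambda>w. SOME v. x w = v +o frac_ideal w)
     in {(u w + to_fract r * w, w) | w r. w \<noteq> 0})"

lemma rho_eq:
  assumes "\<And>w. w \<noteq> 0 \<Longrightarrow> x w = u w +o frac_ideal w"
  shows "rho x = {(u w + to_fract r * w, w) | w r. w \<noteq> 0}"
proof -
  let ?v = "\<lambda>w. SOME v. x w = v +o frac_ideal w"
  have v: "x w = ?v w +o frac_ideal w" if "w \<noteq> 0" for w
    using someI[of "\<lambda>v. x w = v +o frac_ideal w", OF assms[OF that]] .
  have "{(y w + to_fract r * w, w) | w r. w \<noteq> 0} = {(a, w). w \<noteq> 0 \<and> a \<in> x w}"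
    if "\<And>w. w \<noteq> 0 \<Longrightarrow> x w = y w +o frac_ideal w" for y
  proof -
    have "(\<exists>r. a = y w + to_fract r * w) \<longleftrightarrow> a \<in> x w" if "w \<noteq> 0" for a w
      unfolding \<open>\<And>w. w \<noteq> 0 \<Longrightarrow> x w = y w +o frac_ideal w\<close>[OF that] mem_frac_coset
      by (simp only: mult.commute)
    then show ?thesis
      by blast
  qed
  from this[OF v] this[OF assms] show ?thesis
    by (simp add: rho_def Let_def)
qed

end

theory Submission
  imports Defs
begin

text \<open>Read a set \<open>\<xi> \<subseteq> K \<times> K\<^sup>\<times>\<close> as the family of its fibres \<open>\<xi>\<^sub>w = {u. (u, w) \<in> \<xi>}\<close>. For a point \<open>x\<close> of
  the inverse limit, the fibre of \<open>rho x\<close> over \<open>w\<close> is the coset \<open>x w\<close> itself, so the inverse of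
  \<^const>\<open>rho\<close> has to be the map that sends \<open>\<xi>\<close> to its family of fibres. The content of the theorem
  is that the sets in the spectrum are exactly those whose fibres are compatible cosets, each with a
  representative in \<open>R\<close>.

  Since \<open>h \<in> g\<^sup>-\<^sup>1\<xi>\<close> means \<open>gh \<in> \<xi>\<close>, the three families of relations say, for every \<open>(u, w) \<in> \<xi>\<close>: the
  coset \<open>u + (w)\<close> lies in the fibre over \<open>w\<close>; \<open>u\<close> lies in the fibre over \<open>w/m\<close>; and among the
  elements \<open>u + nw\<close> of \<open>u + (w)\<close>, those lying in the fibre over \<open>wm\<close> form exactly one residue class
  of \<open>n\<close> modulo \<open>m\<close> (lemma \<open>spectrum_eq\<close>). Finiteness of \<open>R/(m)\<close> is what makes the sum in the third
  relation count the classes.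

  Such a \<open>\<xi>\<close> has a point with integral first coordinate over every \<open>w = a/b\<close>: go from \<open>(0, 1)\<close> up to
  the modulus \<open>a\<close> and then down by \<open>b\<close>. The decisive step is that two points over the same \<open>w\<close>
  differ by an element of \<open>(w)\<close> (lemma \<open>residue_branching_mem_coset\<close>): with a common denominator \<open>c\<close>
  of all three elements, both points branch off from the single point \<open>(0, 1/c)\<close>, where the
  uniqueness in the third relation compares them.

  Both topologies are initial for coordinates with discrete values, and the coordinates correspond:
  \<open>(u, w) \<in> rho x\<close> depends only on \<open>x w\<close>, and the fibre of \<open>\<xi>\<close> over \<open>w\<close> is the coset \<open>u + (w)\<close> if and
  only if \<open>(u, w) \<in> \<xi>\<close>. Hence \<^const>\<open>rho\<close> and its inverse are both continuous coordinate by
  coordinate.\<close>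

section \<open>Topology\<close>

lemma continuous_map_discrete_codomain_iff:
  "continuous_map X (discrete_topology U) f \<longleftrightarrow>
    f \<in> topspace X \<rightarrow> U \<and> (\<forall>u\<in>U. openin X {x \<in> topspace X. f x = u})"
proof (intro iffI conjI ballI)
  assume f: "continuous_map X (discrete_topology U) f"
  then show "f \<in> topspace X \<rightarrow> U"
    by (auto simp: continuous_map_def)
  show "openin X {x \<in> topspace X. f x = u}" if "u \<in> U" for u
    using openin_continuous_map_preimage[OF f, of "{u}"] that by simp
next
  assume *: "f \<in> topspace X \<rightarrow> U \<and> (\<forall>u\<in>U. openin X {x \<in> topspace X. f x = u})"
  have "openin X {x \<in> topspace X. f x \<in> S}" if "S \<subseteq> U" for S
  proof -
    have "{x \<in> topspace X. f x \<in> S} = (\<Union>u\<in>S. {x \<in> topspace X. f x = u})"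
      by auto
    then show ?thesis
      using * that by (simp only:) (auto intro!: openin_Union)
  qed
  with * show "continuous_map X (discrete_topology U) f"
    by (simp add: continuous_map_def)
qed

lemma continuous_map_powerset_topology_iff:
  "continuous_map T (powerset_topology G) f \<longleftrightarrow>
    f \<in> topspace T \<rightarrow> Pow (carrier G) \<and>
    (\<forall>g\<in>carrier G. openin T {x \<in> topspace T. g \<in> f x} \<and> openin T {x \<in> topspace T. g \<notin> f x})"
    (is "?lhs \<longleftrightarrow> ?rhs")
proof -
  let ?P = "product_topology (\<lambda>_. discrete_topology {0, 1 :: nat}) (carrier G)"
  let ?ind = "\<lambda>\<xi>. restrict (indicator \<xi>) (carrier G) :: _ \<Rightarrow> nat"
  have "?lhs \<longleftrightarrow> f \<in> topspace T \<rightarrow> Pow (carrier G) \<and> continuous_map T ?P (?ind \<circ> f)"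
  proof
    assume f: ?lhs
    have "continuous_map (powerset_topology G) ?P (id \<circ> ?ind)"
      unfolding powerset_topology_def by (rule continuous_map_pullback) simp
    from continuous_map_compose[OF f this]
    show "f \<in> topspace T \<rightarrow> Pow (carrier G) \<and> continuous_map T ?P (?ind \<circ> f)"
      using continuous_map_funspace[OF f] by (simp add: topspace_powerset_topology comp_def)
  next
    assume *: "f \<in> topspace T \<rightarrow> Pow (carrier G) \<and> continuous_map T ?P (?ind \<circ> f)"
    show ?lhs
      unfolding powerset_topology_def by (rule continuous_map_pullback') (use * in auto)
  qed
  also have "continuous_map T ?P (?ind \<circ> f) \<longleftrightarrow>
      (\<forall>g\<in>carrier G. continuous_map T (discrete_topology {0, 1}) (\<lambda>x. (?ind \<circ> f) x g))"
    by (auto simp: continuous_map_componentwise)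
  also have "\<dots> \<longleftrightarrow> (\<forall>g\<in>carrier G. openin T {x \<in> topspace T. g \<notin> f x} \<and>
      openin T {x \<in> topspace T. g \<in> f x})"
    by (auto simp: continuous_map_discrete_codomain_iff indicator_eq_0_iff
        indicator_eq_1_iff simp del: One_nat_def)
  finally show ?thesis
    by blast
qed

lemma openin_powerset_topology_mem:
  assumes "g \<in> carrier G"
  shows "openin (powerset_topology G) {\<xi> \<in> Pow (carrier G). g \<in> \<xi>}"
  using continuous_map_id[of "powerset_topology G"] assms
  unfolding continuous_map_powerset_topology_iff topspace_powerset_topology by simp

section \<open>The spectrum\<close>

lemma (in group) mem_l_coset_inv_iff:
  assumes "\<xi> \<subseteq> carrier G" "g \<in> carrier G" "h \<in> carrier G"
  shows "h \<in> inv g <# \<xi> \<longleftrightarrow> g \<otimes> h \<in> \<xi>"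
proof
  assume "h \<in> inv g <# \<xi>"
  then obtain k where "k \<in> \<xi>" "h = inv g \<otimes> k"
    by (auto simp: l_coset_def)
  with assms show "g \<otimes> h \<in> \<xi>"
    by (auto simp: m_assoc[symmetric] subset_iff)
next
  assume "g \<otimes> h \<in> \<xi>"
  moreover have "h = inv g \<otimes> (g \<otimes> h)"
    using assms by (simp add: m_assoc[symmetric])
  ultimately show "h \<in> inv g <# \<xi>"
    unfolding l_coset_def by blast
qed

lemma affine_group_translate_iff:
  assumes "\<xi> \<subseteq> carrier affine_group" "(u, w) \<in> \<xi>" "w' \<noteq> 0"
  shows "(u', w') \<in> inv\<^bsub>affine_group\<^esub> (u, w) <#\<^bsub>affine_group\<^esub> \<xi> \<longleftrightarrow> (u + u' * w, w * w') \<in> \<xi>"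
  using group.mem_l_coset_inv_iff[OF group_affine_group assms(1), of "(u, w)" "(u', w')"] assms
  by (auto simp: affine_group_def)

lemma sum_one_at_eq_1_iff:
  assumes "finite S"
  shows "(\<Sum>C\<in>S. one_at (h C) \<xi>) = 1 \<longleftrightarrow> (\<exists>!C. C \<in> S \<and> h C \<in> \<xi>)"
proof -
  have "(\<Sum>C\<in>S. one_at (h C) \<xi>) = of_nat (card {C \<in> S. h C \<in> \<xi>})"
    using assms by (simp add: one_at_def sum.If_cases Int_def)
  then show ?thesis
    by (simp add: card_1_singleton_iff set_eq_iff Ex1_def) metis
qed

lemma mem_residue_class_iff: "k \<in> n +o range ((*) m) \<longleftrightarrow> m dvd k - (n :: 'a :: idom)"
  by (auto simp: elt_set_plus_def dvd_def) (metis add.commute diff_add_cancel)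

lemma residue_class_eq:
  assumes "m dvd k - (n :: 'a :: idom)"
  shows "k +o range ((*) m) = n +o range ((*) m)"
  unfolding set_eq_iff mem_residue_class_iff using assms
  by (metis diff_add_cancel add_diff_eq dvd_add_right_iff diff_diff_eq2 add.commute)

text \<open>The conditions of the spectrum without the chosen representatives. The last conjunct, existence
  and uniqueness of a class modulo \<open>m\<close>, replaces the sum over \<open>R/(m)\<close>.\<close>

definition residue_branching :: "('a::idom fract \<times> 'a fract) set \<Rightarrow> bool" where
  "residue_branching \<xi> \<longleftrightarrow>
    \<xi> \<subseteq> carrier affine_group \<and> (0, 1) \<in> \<xi> \<and>
    (\<forall>n u w. (u, w) \<in> \<xi> \<longrightarrow> (u + to_fract n * w, w) \<in> \<xi>) \<and>
    (\<forall>m. m \<noteq> 0 \<longrightarrow> (\<forall>u w. (u, w) \<in> \<xi> \<longrightarrow> (u, w / to_fract m) \<in> \<xi>)) \<and>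
    (\<forall>m. m \<noteq> 0 \<longrightarrow> (\<forall>u w. (u, w) \<in> \<xi> \<longrightarrow>
      (\<exists>n. (u + to_fract n * w, w * to_fract m) \<in> \<xi>) \<and>
      (\<forall>n n'. (u + to_fract n * w, w * to_fract m) \<in> \<xi> \<and>
        (u + to_fract n' * w, w * to_fract m) \<in> \<xi> \<longrightarrow> m dvd n - n')))"

lemma residue_branching_subset: "residue_branching \<xi> \<Longrightarrow> \<xi> \<subseteq> carrier affine_group"
  by (simp add: residue_branching_def)

lemma residue_branching_nonzero: "residue_branching \<xi> \<Longrightarrow> (u, w) \<in> \<xi> \<Longrightarrow> w \<noteq> 0"
  by (drule (1) subsetD[OF residue_branching_subset]) (simp add: affine_group_def)

lemma ex1_range_iff:
  assumes "\<And>n. Q (c n) \<longleftrightarrow> P n"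
  shows "(\<exists>!C. C \<in> range c \<and> Q C) \<longleftrightarrow> (\<exists>n. P n) \<and> (\<forall>n n'. P n \<and> P n' \<longrightarrow> c n = c n')"
  unfolding assms[symmetric] by blast

text \<open>Passing from the representatives to all elements of their classes: a property that is constant
  on residue classes holds at the representative of exactly one class if and only if the elements
  with this property form exactly one class.\<close>

lemma ex1_representative_iff:
  fixes m :: "'a::idom"
  assumes rep: "is_choice_of_reps rep" and "m \<noteq> 0"
    and P: "\<And>n n'. m dvd n - n' \<Longrightarrow> P n \<Longrightarrow> P n'"
  shows "(\<exists>!C. C \<in> residue_ring_set m \<and> P (rep m C)) \<longleftrightarrow>
    (\<exists>n. P n) \<and> (\<forall>n n'. P n \<and> P n' \<longrightarrow> m dvd n - n')"
    (is "?lhs \<longleftrightarrow> ?rhs")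
proof -
  let ?c = "\<lambda>n. n +o range ((*) m)"
  have P_rep: "P (rep m (?c n)) \<longleftrightarrow> P n" for n
  proof -
    have "rep m (?c n) \<in> ?c n"
      using rep \<open>m \<noteq> 0\<close> by (auto simp: is_choice_of_reps_def residue_ring_set_def)
    then have "m dvd rep m (?c n) - n"
      by (simp add: mem_residue_class_iff)
    with P show ?thesis
      by (metis dvd_minus_iff minus_diff_eq)
  qed
  have c_eq: "?c n = ?c n' \<longleftrightarrow> m dvd n - n'" for n n'
  proof
    assume "?c n = ?c n'"
    moreover have "n \<in> ?c n"
      by (simp add: mem_residue_class_iff)
    ultimately have "n \<in> ?c n'"
      by (simp only:)
    then show "m dvd n - n'"
      by (simp add: mem_residue_class_iff)
  qed (rule residue_class_eq)
  have "?lhs \<longleftrightarrow> (\<exists>n. P n) \<and> (\<forall>n n'. P n \<and> P n' \<longrightarrow> ?c n = ?c n')"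
    unfolding residue_ring_set_def by (rule ex1_range_iff) (rule P_rep)
  then show ?thesis
    unfolding c_eq .
qed

lemma ball_relations_iff:
  "(\<forall>f\<in>relations rep. Q f) \<longleftrightarrow>
    (\<forall>n. Q (\<lambda>\<xi>. one_at (to_fract n, 1) \<xi> - 1)) \<and>
    (\<forall>m. m \<noteq> 0 \<longrightarrow> Q (\<lambda>\<xi>. one_at (0, 1 / to_fract m) \<xi> - 1)) \<and>
    (\<forall>m. m \<noteq> 0 \<longrightarrow>
      Q (\<lambda>\<xi>. (\<Sum>C\<in>residue_ring_set m. one_at (to_fract (rep m C), to_fract m) \<xi>) - 1))"
  by (auto simp: relations_def ball_Un)

text \<open>In the third relation, whether \<open>(u + nw, wm)\<close> lies in \<open>\<xi>\<close> depends only on \<open>n\<close> modulo \<open>m\<close>, because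
  the first relation at this point allows shifts by multiples of \<open>wm\<close>. So the condition on the
  representatives is a condition on whole classes.\<close>

lemma spectrum_eq:
  fixes rep :: "'a::idom \<Rightarrow> 'a set \<Rightarrow> 'a"
  assumes fin: "\<And>m :: 'a. m \<noteq> 0 \<Longrightarrow> finite (residue_ring_set m)"
    and rep: "is_choice_of_reps rep"
  shows "spectrum affine_group (relations rep) = {\<xi>. residue_branching \<xi>}"
proof (rule Set.set_eqI)
  fix \<xi> :: "('a fract \<times> 'a fract) set"
  let ?t = "\<lambda>g. inv\<^bsub>affine_group\<^esub> g <#\<^bsub>affine_group\<^esub> \<xi>"
  show "\<xi> \<in> spectrum affine_group (relations rep) \<longleftrightarrow> \<xi> \<in> {\<xi>. residue_branching \<xi>}"
  proof (cases "\<xi> \<subseteq> carrier affine_group \<and> (0, 1) \<in> \<xi>")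
    case False
    then show ?thesis
      by (auto simp: spectrum_def residue_branching_def X_topology_def topspace_powerset_topology
          affine_group_def)
  next
    case True
    then have sub: "\<xi> \<subseteq> carrier affine_group"
      by blast
    have "\<xi> \<in> spectrum affine_group (relations rep) \<longleftrightarrow>
        (\<forall>f\<in>relations rep. \<forall>u w. (u, w) \<in> \<xi> \<longrightarrow> f (?t (u, w)) = 0)"
      using True by (auto simp: spectrum_def X_topology_def topspace_powerset_topology
          affine_group_def)
    also have "\<dots> \<longleftrightarrow>
        (\<forall>n u w. (u, w) \<in> \<xi> \<longrightarrow> (to_fract n, 1) \<in> ?t (u, w)) \<and>
        (\<forall>m. m \<noteq> 0 \<longrightarrow> (\<forall>u w. (u, w) \<in> \<xi> \<longrightarrow> (0, 1 / to_fract m) \<in> ?t (u, w))) \<and>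
        (\<forall>m. m \<noteq> 0 \<longrightarrow> (\<forall>u w. (u, w) \<in> \<xi> \<longrightarrow>
          (\<exists>!C. C \<in> residue_ring_set m \<and> (to_fract (rep m C), to_fract m) \<in> ?t (u, w))))"
    proof -
      have one_at: "one_at g \<eta> - 1 = 0 \<longleftrightarrow> g \<in> \<eta>"
        for g and \<eta> :: "('a fract \<times> 'a fract) set"
        by (simp add: one_at_def)
      have sum: "(\<Sum>C\<in>residue_ring_set m. one_at (to_fract (rep m C), to_fract m) \<eta>) - 1 = 0
          \<longleftrightarrow> (\<exists>!C. C \<in> residue_ring_set m \<and> (to_fract (rep m C), to_fract m) \<in> \<eta>)"
        if "m \<noteq> 0" for m and \<eta> :: "('a fract \<times> 'a fract) set"
        using sum_one_at_eq_1_iff[OF fin[OF that]] by simp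
      show ?thesis
        by (simp only: ball_relations_iff one_at sum simp_thms cong: imp_cong)
    qed
    also have "\<dots> \<longleftrightarrow>
        (\<forall>n u w. (u, w) \<in> \<xi> \<longrightarrow> (u + to_fract n * w, w) \<in> \<xi>) \<and>
        (\<forall>m. m \<noteq> 0 \<longrightarrow> (\<forall>u w. (u, w) \<in> \<xi> \<longrightarrow> (u, w / to_fract m) \<in> \<xi>)) \<and>
        (\<forall>m. m \<noteq> 0 \<longrightarrow> (\<forall>u w. (u, w) \<in> \<xi> \<longrightarrow> (\<exists>!C. C \<in> residue_ring_set m \<and>
            (u + to_fract (rep m C) * w, w * to_fract m) \<in> \<xi>)))"
      by (simp add: affine_group_translate_iff[OF sub] cong: conj_cong imp_cong)
    also have "\<dots> \<longleftrightarrow> residue_branching \<xi>"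
    proof -
      have ex1: "(\<exists>!C. C \<in> residue_ring_set m \<and>
            (u + to_fract (rep m C) * w, w * to_fract m) \<in> \<xi>) \<longleftrightarrow>
          (\<exists>n. (u + to_fract n * w, w * to_fract m) \<in> \<xi>) \<and>
          (\<forall>n n'. (u + to_fract n * w, w * to_fract m) \<in> \<xi> \<and>
            (u + to_fract n' * w, w * to_fract m) \<in> \<xi> \<longrightarrow> m dvd n - n')"
        if shift: "\<And>u w n. (u, w) \<in> \<xi> \<Longrightarrow> (u + to_fract n * w, w) \<in> \<xi>" and "m \<noteq> 0" for u w m
      proof (rule ex1_representative_iff[OF rep \<open>m \<noteq> 0\<close>])
        fix n n'
        assume n: "(u + to_fract n * w, w * to_fract m) \<in> \<xi>" and "m dvd n - n'"
        from \<open>m dvd n - n'\<close> obtain s where "n - n' = m * s" ..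
        then have n': "n' = n + (- s) * m"
          by (simp add: algebra_simps)
        have "u + to_fract n' * w = (u + to_fract n * w) + to_fract (- s) * (w * to_fract m)"
          unfolding n' by (simp add: algebra_simps)
        with shift[OF n] show "(u + to_fract n' * w, w * to_fract m) \<in> \<xi>"
          by metis
      qed
      show ?thesis
        \<comment> \<open>The third condition can be rewritten only when the first one, which occurs on both
          sides, is known.\<close>
      proof (cases "\<forall>n u w. (u, w) \<in> \<xi> \<longrightarrow> (u + to_fract n * w, w) \<in> \<xi>")
        case shift: True
        note ex1' = ex1[OF shift[rule_format]]
        show ?thesis
          unfolding residue_branching_def using True shift
          by (simp add: ex1' cong: conj_cong imp_cong)
      next
        case False
        then show ?thesis
          unfolding residue_branching_def by blast
      qed
    qed
    finally show ?thesis
      by simp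
  qed
qed

section \<open>The fibres of a set in the spectrum\<close>

text \<open>The value at \<open>0\<close> is \<^const>\<open>undefined\<close>, as for the members of \<^const>\<open>Rhat_K\<close>, which are extensional
  functions.\<close>

definition fibre :: "('a::idom fract \<times> 'a fract) set \<Rightarrow> 'a fract \<Rightarrow> 'a fract set" where
  "fibre \<xi> = (\<lambda>w\<in>{w. w \<noteq> 0}. {u. (u, w) \<in> \<xi>})"

lemma fibre_extensional: "fibre \<xi> \<in> extensional {w. w \<noteq> 0}"
  by (simp add: fibre_def)

lemma fract_obtain:
  fixes w :: "'a::idom fract"
  obtains a b where "b \<noteq> 0" "w = to_fract a / to_fract b"
  by (cases w) (auto simp: Fract_conv_to_fract)

lemma common_denominator3:
  fixes u v w :: "'a::idom fract"
  obtains a b d c where "c \<noteq> 0"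
    "u = to_fract a / to_fract c" "v = to_fract b / to_fract c" "w = to_fract d / to_fract c"
proof -
  obtain a a' where "a' \<noteq> 0" "u = to_fract a / to_fract a'" by (rule fract_obtain)
  moreover obtain b b' where "b' \<noteq> 0" "v = to_fract b / to_fract b'" by (rule fract_obtain)
  moreover obtain d d' where "d' \<noteq> 0" "w = to_fract d / to_fract d'" by (rule fract_obtain)
  ultimately show ?thesis
    by (intro that[of "a' * b' * d'" "a * b' * d'" "b * a' * d'" "d * a' * b'"]) auto
qed

text \<open>For \<open>w = a/b\<close>, the third relation at \<open>(0, 1)\<close> with modulus \<open>a\<close> gives a point \<open>(n, a)\<close>, and the
  second relation divides the second coordinate by \<open>b\<close>.\<close>

lemma residue_branching_integral_point:
  fixes \<xi> :: "('a::idom fract \<times> 'a fract) set"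
  assumes \<xi>: "residue_branching \<xi>" and "w \<noteq> 0"
  obtains n where "(to_fract n, w) \<in> \<xi>"
proof -
  obtain a b where ab: "b \<noteq> 0" "w = to_fract a / to_fract b"
    by (rule fract_obtain)
  with \<open>w \<noteq> 0\<close> have "a \<noteq> 0"
    by auto
  have "(0, 1) \<in> \<xi>"
    using \<xi> by (simp add: residue_branching_def)
  then have "\<exists>n. (0 + to_fract n * 1, 1 * to_fract a) \<in> \<xi>"
    using \<xi> \<open>a \<noteq> 0\<close> unfolding residue_branching_def by blast
  then obtain n where "(to_fract n, to_fract a) \<in> \<xi>"
    by auto
  then have "(to_fract n, w) \<in> \<xi>"
    using \<xi> ab unfolding residue_branching_def by blast
  then show ?thesis
    by (rule that)
qed

text \<open>Write \<open>u = a/c\<close>, \<open>v = b/c\<close> and \<open>w = d/c\<close>. The second relation puts \<open>(0, 1/c)\<close> into \<open>\<xi>\<close>, and both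
  given points arise from it by the modulus \<open>d\<close> with the numerators \<open>a\<close> and \<open>b\<close>. Uniqueness of the
  class modulo \<open>d\<close> yields \<open>d dvd b - a\<close>, which after division by \<open>c\<close> is the claim.\<close>

lemma residue_branching_mem_coset:
  fixes \<xi> :: "('a::idom fract \<times> 'a fract) set"
  assumes \<xi>: "residue_branching \<xi>" and u: "(u, w) \<in> \<xi>" and v: "(v, w) \<in> \<xi>"
  shows "v \<in> u +o frac_ideal w"
proof -
  obtain a b d c where c: "c \<noteq> 0" "u = to_fract a / to_fract c" "v = to_fract b / to_fract c"
      "w = to_fract d / to_fract c"
    by (rule common_denominator3)
  have "w \<noteq> 0"
    using \<xi> u by (rule residue_branching_nonzero)
  with c have "d \<noteq> 0"
    by auto
  have "(0, 1) \<in> \<xi>"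
    using \<xi> by (simp add: residue_branching_def)
  then have base: "(0, 1 / to_fract c) \<in> \<xi>"
    using \<xi> \<open>c \<noteq> 0\<close> unfolding residue_branching_def by blast
  have "(0 + to_fract a * (1 / to_fract c), 1 / to_fract c * to_fract d) \<in> \<xi>"
       "(0 + to_fract b * (1 / to_fract c), 1 / to_fract c * to_fract d) \<in> \<xi>"
    using u v c by simp_all
  then have "d dvd b - a"
    using \<xi> base \<open>d \<noteq> 0\<close> unfolding residue_branching_def by blast
  then obtain r where "b - a = d * r" ..
  then have "b = a + d * r"
    by (simp add: algebra_simps)
  then have "v = u + w * to_fract r"
    using c by (simp add: add_divide_distrib)
  then show ?thesis
    unfolding mem_frac_coset by blast
qed

lemma fibre_eq_coset:
  assumes \<xi>: "residue_branching \<xi>" and u: "(u, w) \<in> \<xi>"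
  shows "fibre \<xi> w = u +o frac_ideal w"
proof -
  have "w \<noteq> 0"
    using \<xi> u by (rule residue_branching_nonzero)
  have "(v, w) \<in> \<xi> \<longleftrightarrow> v \<in> u +o frac_ideal w" for v
  proof
    assume "v \<in> u +o frac_ideal w"
    then obtain r where "v = u + to_fract r * w"
      by (auto simp: mem_frac_coset mult.commute)
    then show "(v, w) \<in> \<xi>"
      using \<xi> u by (simp add: residue_branching_def)
  qed (rule residue_branching_mem_coset[OF \<xi> u])
  then have "{v. (v, w) \<in> \<xi>} = u +o frac_ideal w"
    by blast
  with \<open>w \<noteq> 0\<close> show ?thesis
    by (simp add: fibre_def)
qed

lemma to_fract_coset_in_frac_quotient: "to_fract n +o frac_ideal w \<in> frac_quotient w"
proof -
  have "to_fract n + 0 \<in> range to_fract + frac_ideal w"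
    by (intro set_plus_intro) (auto simp: frac_ideal_def intro: range_eqI[of _ _ 0])
  then show ?thesis
    by (simp add: frac_quotient_def)
qed

lemma frac_quotient_obtain:
  assumes "C \<in> frac_quotient w"
  obtains n where "C = to_fract n +o frac_ideal w"
proof -
  obtain n i where "i \<in> frac_ideal w" and C: "C = (to_fract n + i) +o frac_ideal w"
    using assms by (auto simp: frac_quotient_def elim!: set_plus_elim)
  then have "to_fract n + i \<in> to_fract n +o frac_ideal w"
    by (simp add: elt_set_plus_def)
  then have "C = to_fract n +o frac_ideal w"
    unfolding C by (rule frac_coset_eq)
  then show ?thesis
    by (rule that)
qed

text \<open>Compatibility of the fibres over \<open>w\<close> and \<open>wr\<close> is the second relation: a point over \<open>wr\<close> is also
  a point over \<open>w\<close>, so both cosets have a common representative.\<close>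

lemma fibre_in_Rhat_K:
  assumes \<xi>: "residue_branching \<xi>"
  shows "fibre \<xi> \<in> Rhat_K"
proof -
  have "fibre \<xi> w \<in> frac_quotient w" if "w \<noteq> 0" for w
    using residue_branching_integral_point[OF \<xi> that] fibre_eq_coset[OF \<xi>]
      to_fract_coset_in_frac_quotient by metis
  moreover have "frac_proj w (fibre \<xi> w') = fibre \<xi> w"
    if "w \<noteq> 0" "w' \<noteq> 0" and le: "frac_le w w'" for w w'
  proof -
    obtain n where n: "(to_fract n, w') \<in> \<xi>"
      using residue_branching_integral_point[OF \<xi> \<open>w' \<noteq> 0\<close>] .
    obtain r where r: "w' = w * to_fract r"
      using le by (auto simp: frac_le_def)
    with \<open>w' \<noteq> 0\<close> have "r \<noteq> 0" "w = w' / to_fract r"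
      by auto
    then have "(to_fract n, w) \<in> \<xi>"
      using \<xi> n unfolding residue_branching_def by blast
    with n show ?thesis
      by (simp add: fibre_eq_coset[OF \<xi>] frac_proj_coset[OF le])
  qed
  ultimately show ?thesis
    by (auto simp: Rhat_K_def fibre_def)
qed

section \<open>The homeomorphism\<close>

lemma Rhat_K_component:
  assumes "x \<in> Rhat_K" "w \<noteq> 0" "u \<in> x w"
  shows "x w = u +o frac_ideal w"
proof -
  have "x w \<in> frac_quotient w"
    using assms by (auto simp: Rhat_K_def)
  with assms frac_coset_eq show ?thesis
    by (metis frac_quotient_obtain)
qed

lemma Rhat_K_component_nonempty:
  assumes "x \<in> Rhat_K" "w \<noteq> 0"
  obtains n where "to_fract n \<in> x w"
proof -
  have "x w \<in> frac_quotient w"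
    using assms by (auto simp: Rhat_K_def)
  with that frac_coset_self show ?thesis
    by (metis frac_quotient_obtain)
qed

lemma Rhat_K_mono:
  assumes x: "x \<in> Rhat_K" and "w \<noteq> 0" "r \<noteq> 0"
  shows "x (w * to_fract r) \<subseteq> x w"
proof
  fix u assume u: "u \<in> x (w * to_fract r)"
  have le: "frac_le w (w * to_fract r)"
    by (auto simp: frac_le_def)
  have "x w = frac_proj w (x (w * to_fract r))"
    using x le assms(2,3) by (simp add: Rhat_K_def)
  also have "\<dots> = u +o frac_ideal w"
    using Rhat_K_component[OF x _ u] assms(2,3) by (simp add: frac_proj_coset[OF le])
  finally show "u \<in> x w"
    using frac_coset_self by simp
qed

lemma rho_Rhat_K:
  assumes x: "x \<in> Rhat_K"
  shows "rho x = {(u, w). w \<noteq> 0 \<and> u \<in> x w}"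
proof -
  have "\<forall>w. w \<noteq> 0 \<longrightarrow> (\<exists>u. x w = u +o frac_ideal w)"
    using Rhat_K_component_nonempty[OF x] Rhat_K_component[OF x] by metis
  then obtain u where u: "\<And>w. w \<noteq> 0 \<Longrightarrow> x w = u w +o frac_ideal w"
    by metis
  have "v \<in> x w \<longleftrightarrow> (\<exists>r. v = u w + to_fract r * w)" if "w \<noteq> 0" for v w
    by (simp add: u[OF that] mem_frac_coset mult.commute)
  then show ?thesis
    using rho_eq[of x u, OF u] by auto
qed

text \<open>For the class modulo \<open>m\<close> attached to \<open>(u, w)\<close>: by compatibility \<open>x (wm)\<close> is a coset of \<open>(wm)\<close>
  inside \<open>u + (w)\<close>, and such a coset consists of the \<open>u + nw\<close> with \<open>n\<close> in one class modulo \<open>m\<close>.\<close>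

lemma residue_branching_rho:
  assumes x: "x \<in> Rhat_K"
  shows "residue_branching (rho x)"
  unfolding residue_branching_def
proof (intro conjI allI impI)
  note rho = rho_Rhat_K[OF x]
  show "rho x \<subseteq> carrier affine_group"
    by (auto simp: rho affine_group_def)
  obtain n where "to_fract n \<in> x 1"
    using Rhat_K_component_nonempty[OF x, of 1] by auto
  then have "x 1 = to_fract n +o frac_ideal 1"
    using Rhat_K_component[OF x] by simp
  then show "(0, 1) \<in> rho x"
    by (auto simp: rho mem_frac_coset intro: exI[of _ "- n"])
  show "(u + to_fract n * w, w) \<in> rho x" if "(u, w) \<in> rho x" for n u w
  proof -
    have w: "w \<noteq> 0" "u \<in> x w"
      using that by (auto simp: rho)
    then show ?thesis
      using Rhat_K_component[OF x w] by (auto simp: rho mem_frac_coset mult.commute)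
  qed
  show "(u, w / to_fract m) \<in> rho x" if "m \<noteq> 0" "(u, w) \<in> rho x" for m u w
    using that Rhat_K_mono[OF x, of "w / to_fract m" m] by (auto simp: rho)
  show "\<exists>n. (u + to_fract n * w, w * to_fract m) \<in> rho x" if "m \<noteq> 0" "(u, w) \<in> rho x" for m u w
  proof -
    have w: "w \<noteq> 0" "u \<in> x w" and m: "m \<noteq> 0"
      using that by (auto simp: rho)
    then obtain k where k: "to_fract k \<in> x (w * to_fract m)"
      using Rhat_K_component_nonempty[OF x, of "w * to_fract m"] by auto
    then have "to_fract k \<in> u +o frac_ideal w"
      using Rhat_K_mono[OF x \<open>w \<noteq> 0\<close> m] Rhat_K_component[OF x w] by auto
    then obtain n where "to_fract k = u + to_fract n * w"
      by (auto simp: mem_frac_coset mult.commute)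
    with k w m show ?thesis
      by (auto simp: rho intro!: exI[of _ n])
  qed
  show "m dvd n - n'" if "m \<noteq> 0" "(u, w) \<in> rho x" and
    *: "(u + to_fract n * w, w * to_fract m) \<in> rho x \<and> (u + to_fract n' * w, w * to_fract m) \<in> rho x"
    for m u w n n'
  proof -
    have w: "w \<noteq> 0" "w * to_fract m \<noteq> 0"
      "u + to_fract n * w \<in> x (w * to_fract m)" "u + to_fract n' * w \<in> x (w * to_fract m)"
      using * by (auto simp: rho)
    then have "u + to_fract n * w \<in> (u + to_fract n' * w) +o frac_ideal (w * to_fract m)"
      using Rhat_K_component[OF x w(2,4)] by simp
    then obtain r where "u + to_fract n * w = u + to_fract n' * w + w * to_fract m * to_fract r"
      by (auto simp: mem_frac_coset)
    then have "w * to_fract n = w * to_fract (n' + m * r)"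
      by (simp add: algebra_simps)
    then have "n = n' + m * r"
      using w(1) by (simp only: mult_cancel_left to_fract_eq_iff) simp
    then show ?thesis
      by simp
  qed
qed

lemma fibre_rho:
  assumes x: "x \<in> Rhat_K"
  shows "fibre (rho x) = x"
proof
  show "fibre (rho x) w = x w" for w
    using x by (cases "w = 0") (auto simp: fibre_def rho_Rhat_K[OF x] Rhat_K_def)
qed

lemma rho_fibre:
  assumes \<xi>: "residue_branching \<xi>"
  shows "rho (fibre \<xi>) = \<xi>"
  unfolding rho_Rhat_K[OF fibre_in_Rhat_K[OF \<xi>]]
  using residue_branching_nonzero[OF \<xi>] by (auto simp: fibre_def)

theorem proposition4p3:
  fixes rep :: "'a::idom \<Rightarrow> 'a set \<Rightarrow> 'a"
  assumes "\<And>m :: 'a. m \<noteq> 0 \<Longrightarrow> finite (residue_ring_set m)"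
    and "is_choice_of_reps rep"
  shows "homeomorphic_map Rhat_K_topology (Omega_topology rep) rho"
proof -
  let ?\<Omega> = "{\<xi> :: ('a fract \<times> 'a fract) set. residue_branching \<xi>}"
  have Omega: "Omega_topology rep = subtopology (powerset_topology affine_group) ?\<Omega>"
  proof -
    have "{\<xi>. \<one>\<^bsub>affine_group\<^esub> \<in> \<xi>} \<inter> ?\<Omega> = ?\<Omega>"
      by (auto simp: residue_branching_def affine_group_def)
    then show ?thesis
      by (simp add: Omega_topology_def X_topology_def spectrum_eq[OF assms] subtopology_subtopology)
  qed
  have top_Omega: "topspace (Omega_topology rep) = ?\<Omega>"
    using residue_branching_subset by (auto simp: Omega topspace_powerset_topology)

  have "continuous_map (Rhat_K_topology :: ('a fract \<Rightarrow> 'a fract set) topology)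
      (powerset_topology affine_group) rho"
    unfolding continuous_map_powerset_topology_iff topspace_Rhat_K_topology
  proof (intro conjI ballI)
    show "(rho :: ('a fract \<Rightarrow> 'a fract set) \<Rightarrow> _) \<in> Rhat_K \<rightarrow> Pow (carrier affine_group)"
      using residue_branching_subset[OF residue_branching_rho] by blast
    fix g :: "'a fract \<times> 'a fract"
    assume "g \<in> carrier affine_group"
    then obtain u w where g: "g = (u, w)" "w \<noteq> 0"
      by (auto simp: affine_group_def)
    have proj: "continuous_map Rhat_K_topology (discrete_topology (frac_quotient w)) (\<lambda>x. x w)"
      unfolding Rhat_K_topology_def
      by (intro continuous_map_from_subtopology continuous_map_product_projection) (simp add: g)
    have mem: "g \<in> rho x \<longleftrightarrow> u \<in> x w" if "x \<in> Rhat_K" for x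
      using rho_Rhat_K[OF that] g by auto
    have comp: "x w \<in> frac_quotient w" if "x \<in> Rhat_K" for x
      using that g by (auto simp: Rhat_K_def)
    have preimage: "openin Rhat_K_topology {x \<in> Rhat_K. x w \<in> S}" if "S \<subseteq> frac_quotient w" for S
      using openin_continuous_map_preimage[OF proj, of S] that
      by (simp add: topspace_Rhat_K_topology)
    have "{x \<in> Rhat_K. g \<in> rho x} = {x \<in> Rhat_K. x w \<in> {C \<in> frac_quotient w. u \<in> C}}"
      using mem comp by auto
    also have "openin Rhat_K_topology \<dots>"
      by (rule preimage) blast
    finally show "openin Rhat_K_topology {x \<in> Rhat_K. g \<in> rho x}" .
    have "{x \<in> Rhat_K. g \<notin> rho x} = {x \<in> Rhat_K. x w \<in> {C \<in> frac_quotient w. u \<notin> C}}"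
      using mem comp by auto
    also have "openin Rhat_K_topology \<dots>"
      by (rule preimage) blast
    finally show "openin Rhat_K_topology {x \<in> Rhat_K. g \<notin> rho x}" .
  qed
  then have rho: "continuous_map Rhat_K_topology (Omega_topology rep) rho"
    unfolding Omega continuous_map_in_subtopology topspace_Rhat_K_topology
    by (simp add: Pi_iff residue_branching_rho)

  have "continuous_map (Omega_topology rep) (discrete_topology (frac_quotient w)) (\<lambda>\<xi>. fibre \<xi> w)"
    if "w \<noteq> 0" for w :: "'a fract"
    unfolding continuous_map_discrete_codomain_iff top_Omega
  proof (intro conjI ballI)
    show "(\<lambda>\<xi>. fibre \<xi> w) \<in> ?\<Omega> \<rightarrow> frac_quotient w"
      using fibre_in_Rhat_K \<open>w \<noteq> 0\<close> by (auto simp: Rhat_K_def)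
    fix C
    assume "C \<in> frac_quotient w"
    then obtain n where C: "C = to_fract n +o frac_ideal w"
      by (rule frac_quotient_obtain)
    have "fibre \<xi> w = C \<longleftrightarrow> (to_fract n, w) \<in> \<xi>" if "residue_branching \<xi>" for \<xi>
    proof
      assume "fibre \<xi> w = C"
      then have "to_fract n \<in> fibre \<xi> w"
        by (simp add: C frac_coset_self)
      then show "(to_fract n, w) \<in> \<xi>"
        using \<open>w \<noteq> 0\<close> by (simp add: fibre_def)
    qed (simp add: C fibre_eq_coset[OF that])
    then have "{\<xi> \<in> ?\<Omega>. fibre \<xi> w = C} =
        {\<xi> \<in> Pow (carrier affine_group). (to_fract n, w) \<in> \<xi>} \<inter> ?\<Omega>"
      using residue_branching_subset by blast
    moreover have "openin (powerset_topology affine_group)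
        {\<xi> \<in> Pow (carrier affine_group). (to_fract n, w) \<in> \<xi>}"
      using \<open>w \<noteq> 0\<close> by (intro openin_powerset_topology_mem) (simp add: affine_group_def)
    ultimately show "openin (Omega_topology rep) {\<xi> \<in> ?\<Omega>. fibre \<xi> w = C}"
      unfolding Omega by (simp only: openin_subtopology_Int)
  qed
  then have fibre: "continuous_map (Omega_topology rep) Rhat_K_topology fibre"
    unfolding Rhat_K_topology_def continuous_map_in_subtopology continuous_map_componentwise top_Omega
    using fibre_in_Rhat_K by (auto simp: fibre_extensional)

  have "homeomorphic_maps Rhat_K_topology (Omega_topology rep) rho fibre"
    using rho fibre
    by (simp add: homeomorphic_maps_def topspace_Rhat_K_topology top_Omega fibre_rho rho_fibre)
  then show ?thesis
    unfolding homeomorphic_map_maps by blast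
qed

end
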